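(* Let $U:\mathbb{R}^d\to[0,\infty]$ be measurable with $0<\int_{\mathbb{R}^d}e^{-\theta U(x)}\,dx<\infty$ for all $\theta\ge 1$. Let $0\le\kappa_0<\kappa_1$ and $m>0$. Suppose that for some $R\in(0,\infty]$ and $x_*\in\mathbb{R}^d$ with $U(x_* )<\infty$, $$U(x)=+\infty\quad\text{for } |x-x_*|>R,$$ and $$\kappa_0|x-x_*|^{m}\le U(x)-U(x_* )\le\kappa_1|x-x_*|^{m}\quad\text{for } |x-x_*|<R.$$ For $\theta\ge1$ let $X_1^\theta,\dots,X_N^\theta$ be i.i.d. random variables with common distribution $\mu_\theta(dx)\propto e^{-\theta U(x)}\,dx$. Then for all $p\ge 1$, $N\in\mathbb{N}$ and all $\theta\ge 1$ with $\theta\ge d/(m\kappa_1R^m)$, $$\left\|1-e^{U(x_* )-\inf_{n=1,\dots,N}U(X^\theta_n)}\right\|_{L^p(\Omega)}\le\frac{d}{\theta m}+e^{-N(\kappa_0/\kappa_1)^{d/m}/(2p)}.$$ In particular, $$\lim_{\theta\to\infty}\left\|1-e^{U(x_* )-\inf_{n=1,\dots,N}U(X^\theta_n)}\right\|_{L^p(\Omega)}\le e^{-N(\kappa_0/\kappa_1)^{d/m}/p},$$ and $$\lim_{N\to\infty}\left\|1-e^{U(x_* )-\inf_{n=1,\dots,N}U(X^\theta_n)}\right\|_{L^p(\Omega)}\le\frac{d}{\theta m}.$$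
   Context: $|\cdot|$ is the Euclidean norm on $\mathbb{R}^d$ and $\|\cdot\|_{L^p(\Omega)}$ is the $L^p$-norm on the underlying probability space. $\mu_\theta(dx)\propto e^{-\theta U(x)}dx$ means that $\mu_\theta$ is the probability measure with density $e^{-\theta U(x)}/\int_{\mathbb{R}^d}e^{-\theta U(y)}\,dy$, with the convention $e^{-\infty}=0$. When $R=\infty$, the condition $|x-x_*|>R$ is void and $d/(m\kappa_1R^m)$ is read as $0$. In the last limit, $\theta$ is any fixed value with $\theta\ge1$ and $\theta\ge d/(m\kappa_1R^m)$. *)

theory Defs
  imports "HOL-Probability.Probability"
begin

(* The exponential on [-\<infinity>, \<infinity>], with e^(-\<infinity>) = 0 and e^\<infinity> = \<infinity>. *)
definition eexp :: "ereal \<Rightarrow> ennreal" where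
  "eexp x = (case x of ereal r \<Rightarrow> ennreal (exp r) | PInfty \<Rightarrow> \<infinity> | MInfty \<Rightarrow> 0)"

definition partition_fun :: "(real ^ 'd \<Rightarrow> ereal) \<Rightarrow> real \<Rightarrow> ennreal" where
  "partition_fun U \<theta> = (\<integral>\<^sup>+ x. eexp (- (ereal \<theta> * U x)) \<partial>lborel)"

definition gibbs :: "(real ^ 'd \<Rightarrow> ereal) \<Rightarrow> real \<Rightarrow> (real ^ 'd) measure" where
  "gibbs U \<theta> = density lborel (\<lambda>x. eexp (- (ereal \<theta> * U x)) / partition_fun U \<theta>)"

definition iid_sample ::
    "'w measure \<Rightarrow> (real ^ 'd) measure \<Rightarrow> nat \<Rightarrow> (nat \<Rightarrow> 'w \<Rightarrow> real ^ 'd) \<Rightarrow> bool" where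
  "iid_sample M \<mu> N Y \<longleftrightarrow>
     prob_space.indep_vars M (\<lambda>_. borel) Y {1..N} \<and>
     (\<forall>n\<in>{1..N}. distr M borel (Y n) = \<mu>)"

(* Valued in [0, \<infinity>], so that an upper bound on it also asserts p-integrability. *)
definition Lp_norm :: "'w measure \<Rightarrow> real \<Rightarrow> ('w \<Rightarrow> real) \<Rightarrow> ennreal" where
  "Lp_norm M p f =
     (let I = \<integral>\<^sup>+ \<omega>. ennreal (\<bar>f \<omega>\<bar> powr p) \<partial>M
      in if I = \<infinity> then \<infinity> else ennreal (enn2real I powr (1 / p)))"

(* The random variable 1 - e^(U(x_star) - min U(Y_n)). If U is nonnegative and U(x_star) is
   finite, then the exponent is below \<infinity> and enn2real is applied to a finite value only. *)
definition gap_error ::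
    "(real ^ 'd \<Rightarrow> ereal) \<Rightarrow> real ^ 'd \<Rightarrow> nat \<Rightarrow> (nat \<Rightarrow> 'w \<Rightarrow> real ^ 'd) \<Rightarrow> 'w \<Rightarrow> real" where
  "gap_error U xs N Y \<omega> = 1 - enn2real (eexp (U xs - (INF n\<in>{1..N}. U (Y n \<omega>))))"

(* d / (m \<kappa>\<^sub>1 R^m), read as 0 for R = \<infinity>; only used for R > 0. *)
definition theta_threshold :: "real \<Rightarrow> real \<Rightarrow> real \<Rightarrow> ereal \<Rightarrow> real" where
  "theta_threshold d m \<kappa>1 R = (case R of ereal r \<Rightarrow> d / (m * \<kappa>1 * r powr m) | _ \<Rightarrow> 0)"

end

theory Submission
  imports Defs "HOL-Real_Asymp.Real_Asymp"
begin

text \<open>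
  Write \<open>u = U(x\<^sub>*)\<close> and \<open>t \<ge> 0\<close>. If some sample point lies in the sublevel set \<open>{U \<le> u + t}\<close>,
  the error is at most \<open>1 - e\<^sup>-\<^sup>t \<le> t\<close>; otherwise it is at most 1. By independence the second
  event has probability \<open>h\<^sup>N\<close> with \<open>h = \<mu>\<^sub>\<theta>(U > u + t)\<close>, so the \<open>L\<^sup>p\<close>-norm is at most
  \<open>t + h powr (N / p)\<close> (\<open>Lp_norm_gap_error_le\<close>). All three claims follow by estimating \<open>h\<close>.

  For the explicit bound take \<open>t = d / (\<theta> m)\<close>. Replacing \<open>U - u\<close> by its lower bound in the
  normalising integral and by its upper bound on the ball \<open>{\<theta> \<kappa>\<^sub>1 |x - x\<^sub>*|\<^sup>m \<le> d / m}\<close> (which the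
  condition on \<open>\<theta>\<close> places inside the ball of radius \<open>R\<close>) leaves two radial integrals. If \<open>x\<close>
  has density proportional to \<open>exp (- l |x|\<^sup>m)\<close>, then \<open>l |x|\<^sup>m\<close> is Gamma distributed with shape
  and mean \<open>a = d / m\<close>. Rescaling produces the factor \<open>(\<kappa>\<^sub>0 / \<kappa>\<^sub>1) powr a\<close>, and the factor
  \<open>1 / 2\<close> is the fact that the median of a Gamma distribution does not exceed its mean. In
  the variable \<open>y = ln a - ln (l |x|\<^sup>m)\<close> the latter becomes a comparison of the density at \<open>y\<close>
  and \<open>-y\<close>, that is, \<open>sinh y \<ge> y\<close> for \<open>y \<ge> 0\<close>. Hence \<open>h \<le> 1 - q \<le> e\<^sup>-\<^sup>q\<close> with
  \<open>q = (\<kappa>\<^sub>0 / \<kappa>\<^sub>1) powr a / 2\<close> (\<open>gibbs_mass_near_minimum\<close>).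

  Both limits are in fact 0. Every sublevel set \<open>{U \<le> u + t}\<close> with \<open>t > 0\<close> contains a ball, so
  \<open>h < 1\<close> and \<open>h powr (N / p) \<rightarrow> 0\<close> as \<open>N \<rightarrow> \<infinity>\<close>. As \<open>\<theta> \<rightarrow> \<infinity>\<close>, Gibbs measures
  concentrate on sublevel sets of positive mass, so \<open>h \<rightarrow> 0\<close> exponentially fast
  (\<open>gibbs_tail_decay\<close>). In either case \<open>t\<close> can be made arbitrarily small afterwards.
\<close>

section \<open>Radial integrals and the median of the Gamma distribution\<close>

text \<open>
  The logarithmic radius turns Lebesgue measure into an exponential weight, because balls have
  volume proportional to \<open>r\<^sup>d\<close>. The sign is chosen so that upper half-lines correspond to
  balls and have finite mass, which allows the two measures to be compared on half-lines alone.
  The offset \<open>ln (a / l)\<close> places the origin at the radius where \<open>l |x - c|\<^sup>m = a\<close>.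
\<close>

lemma distr_neg_log_norm_power:
  fixes c :: "'a::euclidean_space" and l m a :: real
  assumes l: "l > 0" and m: "m > 0" and a: "a = real DIM('a) / m"
  shows "distr lborel borel (\<lambda>x::'a. ln (a / l) - m * ln (norm (x - c)))
       = density lborel (\<lambda>y. ennreal (unit_ball_vol (real DIM('a)) * a * (a / l) powr a * exp (- (a * y))))"
    (is "?L = ?D")
proof -
  have apos: "a > 0" using m by (simp add: a)
  define k where "k = unit_ball_vol (real DIM('a)) * (a / l) powr a"
  have kpos: "k \<ge> 0" by (simp add: k_def)
  have L: "emeasure ?L {t<..} = ennreal (k * exp (- (a * t)))" for t
  proof -
    define r where "r = (a / l * exp (- t)) powr (1 / m)"
    have rpos: "r > 0" using apos l by (simp add: r_def)
    have ln_r: "m * ln r = ln (a / l) - t"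
      using apos l m by (simp add: r_def ln_powr ln_mult ln_div)
    \<comment> \<open>The centre must be excluded: there \<open>ln 0 = 0\<close>, whereas the true logarithmic radius is infinite.\<close>
    have iff: "t < ln (a / l) - m * ln (norm (x - c)) \<longleftrightarrow> x \<in> ball c r" if "x \<noteq> c" for x
    proof -
      have "t < ln (a / l) - m * ln (norm (x - c)) \<longleftrightarrow> m * ln (norm (x - c)) < m * ln r"
        by (simp add: ln_r algebra_simps)
      also have "\<dots> \<longleftrightarrow> norm (x - c) < r"
        using m that rpos by simp
      finally show ?thesis by (simp add: dist_norm norm_minus_commute)
    qed
    have "emeasure ?L {t<..} = emeasure lborel {x. t < ln (a / l) - m * ln (norm (x - c))}"
      by (subst emeasure_distr) (auto simp: vimage_def)
    also have "\<dots> = emeasure lborel (ball c r)"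
    proof (rule emeasure_eq_AE)
      have "AE x in lborel. x \<noteq> c" by (rule AE_lborel_singleton)
      thus "AE x in lborel. (x \<in> {x. t < ln (a / l) - m * ln (norm (x - c))}) = (x \<in> ball c r)"
        by eventually_elim (use iff in blast)
    qed measurable
    also have "\<dots> = ennreal (unit_ball_vol (real DIM('a)) * r ^ DIM('a))"
      using rpos by (intro emeasure_ball) simp
    also have "r ^ DIM('a) = (a / l) powr a * exp (- (a * t))"
    proof -
      have "r ^ DIM('a) = (a / l * exp (- t)) powr a"
        using rpos m by (simp add: powr_realpow[symmetric] r_def powr_powr a)
      thus ?thesis using apos l by (simp add: powr_mult exp_powr_real mult.commute powr_divide)
    qed
    finally show ?thesis by (simp add: k_def mult.assoc)
  qed
  have D: "emeasure ?D {t<..} = ennreal (k * exp (- (a * t)))" for t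
  proof -
    have "emeasure ?D {t<..} = (\<integral>\<^sup>+y. ennreal (k * a * exp (- (a * y))) * indicator {t<..} y \<partial>lborel)"
      by (subst emeasure_density) (auto simp: k_def mult_ac)
    also have "\<dots> = (\<integral>\<^sup>+y. ennreal (k * a * exp (- (a * y))) * indicator {t..} y \<partial>lborel)"
      using AE_lborel_singleton[of t] by (intro nn_integral_cong_AE) (auto split: split_indicator)
    also have "\<dots> = ennreal (0 - (- k * exp (- (a * t))))"
    proof (rule nn_integral_FTC_atLeast)
      have "filterlim (\<lambda>x. - (a * x)) at_bot at_top"
        using apos by (auto simp: filterlim_uminus_at_bot filterlim_ident
            intro!: filterlim_tendsto_pos_mult_at_top[where c = a])
      hence "((\<lambda>x. - k * exp (- (a * x))) \<longlongrightarrow> - k * 0) at_top"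
        by (intro tendsto_intros filterlim_compose[OF exp_at_bot])
      thus "((\<lambda>x. - k * exp (- (a * x))) \<longlongrightarrow> 0) at_top" by simp
    qed (use apos kpos in \<open>auto intro!: derivative_eq_intros\<close>)
    finally show ?thesis by simp
  qed
  show ?thesis by (rule measure_eqI_lessThan) (auto simp: L D)
qed

text \<open>
  This replaces polar coordinates. The parameter \<open>l\<close> enters the right-hand side only through
  the prefactor, so integrals with different \<open>l\<close> can be compared without a separate rescaling.
\<close>

lemma nn_integral_radial_power:
  fixes c :: "'a::euclidean_space" and l m a :: real and h :: "real \<Rightarrow> ennreal"
  assumes l: "l > 0" and m: "m > 0" and a: "a = real DIM('a) / m"
    and [measurable]: "h \<in> borel_measurable borel"
  shows "(\<integral>\<^sup>+x. h (l * norm (x - c) powr m) \<partial>lborel)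
       = ennreal (unit_ball_vol (real DIM('a)) * a * (a / l) powr a)
         * (\<integral>\<^sup>+y. ennreal (exp (- (a * y))) * h (a * exp (- y)) \<partial>lborel)"
proof -
  have apos: "a > 0" using m by (simp add: a)
  let ?\<phi> = "\<lambda>x::'a. ln (a / l) - m * ln (norm (x - c))"
  have "(\<integral>\<^sup>+x. h (l * norm (x - c) powr m) \<partial>lborel) = (\<integral>\<^sup>+x. h (a * exp (- ?\<phi> x)) \<partial>lborel)"
  proof (rule nn_integral_cong_AE)
    have "AE x in lborel. x \<noteq> c" by (rule AE_lborel_singleton)
    thus "AE x in lborel. h (l * norm (x - c) powr m) = h (a * exp (- ?\<phi> x))"
    proof eventually_elim
      case (elim x)
      have "a * exp (- ?\<phi> x) = l * norm (x - c) powr m"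
        using elim apos l by (simp add: exp_diff powr_def)
      thus ?case by simp
    qed
  qed
  also have "\<dots> = (\<integral>\<^sup>+y. h (a * exp (- y)) \<partial>distr lborel borel ?\<phi>)"
    by (subst nn_integral_distr) auto
  also have "\<dots> = (\<integral>\<^sup>+y. ennreal (unit_ball_vol (real DIM('a)) * a * (a / l) powr a)
         * (ennreal (exp (- (a * y))) * h (a * exp (- y))) \<partial>lborel)"
    unfolding distr_neg_log_norm_power[OF l m a] using apos
    by (subst nn_integral_density) (auto simp: ennreal_mult mult.assoc)
  finally show ?thesis by (simp add: nn_integral_cmult)
qed

text \<open>
  A Gamma variable \<open>s\<close> of shape \<open>a\<close>, written as \<open>s = a e\<^sup>-\<^sup>y\<close>, has density proportional to
  \<open>f\<close>, and \<open>y \<ge> 0\<close> means \<open>s \<le> a\<close>. The median is at most the mean because reflection at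
  the mode \<open>y = 0\<close> does not increase the density: \<open>f (-y) \<le> f y\<close> for \<open>y \<ge> 0\<close> reduces to
  \<open>y \<le> sinh y\<close>.
\<close>

lemma gamma_half_mass_below_mean:
  fixes a :: real
  assumes "a \<ge> 0"
  defines "f \<equiv> \<lambda>y. ennreal (exp (- (a * y))) * ennreal (exp (- (a * exp (- y))))"
  shows "(\<integral>\<^sup>+y. f y \<partial>lborel) \<le> 2 * (\<integral>\<^sup>+y. f y * indicator {0..} y \<partial>lborel)"
proof -
  have [measurable]: "f \<in> borel_measurable borel" by (simp add: f_def)
  have refl_le: "f (- y) \<le> f y" if "y \<ge> 0" for y
  proof -
    have "2 * y \<le> exp y - exp (- y)"
      using real_le_x_sinh[OF that] by (simp add: exp_minus)
    hence "a * (2 * y) \<le> a * (exp y - exp (- y))"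
      using assms(1) by (rule mult_left_mono)
    thus ?thesis
      by (simp add: f_def flip: ennreal_mult exp_add) (simp add: algebra_simps)
  qed
  have "(\<integral>\<^sup>+y. f y * indicator {..<0} y \<partial>lborel) = (\<integral>\<^sup>+y. f (- y) * indicator {..<0} (- y) \<partial>lborel)"
    using nn_integral_real_affine[of "\<lambda>y. f y * indicator {..<0} y" "-1" 0] by simp
  also have "\<dots> \<le> (\<integral>\<^sup>+y. f y * indicator {0..} y \<partial>lborel)"
    by (intro nn_integral_mono) (auto split: split_indicator intro: refl_le)
  finally have left: "(\<integral>\<^sup>+y. f y * indicator {..<0} y \<partial>lborel) \<le> (\<integral>\<^sup>+y. f y * indicator {0..} y \<partial>lborel)" .
  have "(\<integral>\<^sup>+y. f y \<partial>lborel) = (\<integral>\<^sup>+y. f y * indicator {..<0} y + f y * indicator {0..} y \<partial>lborel)"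
    by (intro nn_integral_cong) (auto split: split_indicator)
  also have "\<dots> = (\<integral>\<^sup>+y. f y * indicator {..<0} y \<partial>lborel) + (\<integral>\<^sup>+y. f y * indicator {0..} y \<partial>lborel)"
    by (rule nn_integral_add) auto
  finally show ?thesis using left by (simp add: mult_2)
qed

text \<open>
  In the coordinate \<open>y\<close> both sides are integrals of the same Gamma density, with prefactors whose
  quotient is \<open>(l0 / l1) powr a\<close>; the truncation on the right is \<open>y \<ge> 0\<close>. For \<open>l0 = 0\<close> the
  left-hand side is \<open>0 \<cdot> \<infinity> = 0\<close>.
\<close>

lemma exp_radial_half_mass:
  fixes c :: "'a::euclidean_space" and l0 l1 m a :: real
  assumes l: "l0 \<ge> 0" "l1 > 0" and m: "m > 0" and a: "a = real DIM('a) / m"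
  shows "ennreal ((l0 / l1) powr a / 2) * (\<integral>\<^sup>+x. ennreal (exp (- (l0 * norm (x - c) powr m))) \<partial>lborel)
     \<le> (\<integral>\<^sup>+x. ennreal (exp (- (l1 * norm (x - c) powr m)))
            * indicator {x. l1 * norm (x - c) powr m \<le> a} x \<partial>lborel)"
proof (cases "l0 = 0")
  case False
  with l have l0: "l0 > 0" by simp
  have apos: "a > 0" using m by (simp add: a)
  define f where "f = (\<lambda>y. ennreal (exp (- (a * y))) * ennreal (exp (- (a * exp (- y)))))"
  define v where "v = unit_ball_vol (real DIM('a)) * a"
  have vpos: "v \<ge> 0" using apos by (simp add: v_def)
  have I0: "(\<integral>\<^sup>+x. ennreal (exp (- (l0 * norm (x - c) powr m))) \<partial>lborel)
      = ennreal (v * (a / l0) powr a) * (\<integral>\<^sup>+y. f y \<partial>lborel)"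
    using nn_integral_radial_power[OF l0 m a, of "\<lambda>s. ennreal (exp (- s))" c] by (simp add: f_def v_def)
  have "(\<integral>\<^sup>+x. ennreal (exp (- (l1 * norm (x - c) powr m)))
            * indicator {x. l1 * norm (x - c) powr m \<le> a} x \<partial>lborel)
      = (\<integral>\<^sup>+x. ennreal (exp (- (l1 * norm (x - c) powr m))) * indicator {..a} (l1 * norm (x - c) powr m) \<partial>lborel)"
    by (intro nn_integral_cong) (auto split: split_indicator)
  also have "\<dots> = ennreal (v * (a / l1) powr a)
      * (\<integral>\<^sup>+y. ennreal (exp (- (a * y))) * (ennreal (exp (- (a * exp (- y)))) * indicator {..a} (a * exp (- y))) \<partial>lborel)"
    using nn_integral_radial_power[OF l(2) m a, of "\<lambda>s. ennreal (exp (- s)) * indicator {..a} s" c]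
    by (simp add: v_def)
  also have "(\<integral>\<^sup>+y. ennreal (exp (- (a * y))) * (ennreal (exp (- (a * exp (- y)))) * indicator {..a} (a * exp (- y))) \<partial>lborel)
      = (\<integral>\<^sup>+y. f y * indicator {0..} y \<partial>lborel)"
    using apos by (intro nn_integral_cong) (auto simp: f_def split: split_indicator)
  finally have I1: "(\<integral>\<^sup>+x. ennreal (exp (- (l1 * norm (x - c) powr m)))
            * indicator {x. l1 * norm (x - c) powr m \<le> a} x \<partial>lborel)
      = ennreal (v * (a / l1) powr a) * (\<integral>\<^sup>+y. f y * indicator {0..} y \<partial>lborel)" .
  have "(l0 / l1) powr a * (a / l0) powr a = (a / l1) powr a"
    using l0 l(2) apos by (simp flip: powr_mult)
  hence coeff: "(l0 / l1) powr a / 2 * (v * (a / l0) powr a) = v * (a / l1) powr a * (1 / 2)"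
    by (simp add: field_simps)
  have "ennreal ((l0 / l1) powr a / 2) * (ennreal (v * (a / l0) powr a) * (\<integral>\<^sup>+y. f y \<partial>lborel))
      = ennreal (v * (a / l1) powr a * (1 / 2)) * (\<integral>\<^sup>+y. f y \<partial>lborel)"
    unfolding coeff[symmetric] using vpos by (subst ennreal_mult[of "(l0 / l1) powr a / 2"]) (auto simp: mult.assoc)
  also have "\<dots> \<le> ennreal (v * (a / l1) powr a * (1 / 2)) * (2 * (\<integral>\<^sup>+y. f y * indicator {0..} y \<partial>lborel))"
    using gamma_half_mass_below_mean[of a] apos by (intro mult_left_mono) (auto simp: f_def)
  also have "\<dots> = ennreal (v * (a / l1) powr a) * (\<integral>\<^sup>+y. f y * indicator {0..} y \<partial>lborel)"
  proof -
    have "ennreal (v * (a / l1) powr a * (1 / 2)) * 2 = ennreal (v * (a / l1) powr a * (1 / 2) * 2)"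
      using vpos by (subst ennreal_mult) auto
    thus ?thesis by (simp flip: mult.assoc)
  qed
  finally show ?thesis by (simp only: I0 I1)
qed simp

section \<open>Gibbs measures\<close>

lemma borel_measurable_eexp [measurable]: "eexp \<in> borel_measurable borel"
proof -
  have "eexp = (\<lambda>x. if x = \<infinity> then \<infinity> else if x = -\<infinity> then 0 else ennreal (exp (real_of_ereal x)))"
    by (rule ext) (auto simp: eexp_def split: ereal.splits)
  thus ?thesis by (rule ssubst) measurable
qed

lemma ennreal_measure_gibbs_mult_partition_fun:
  fixes U :: "real ^ 'd \<Rightarrow> ereal"
  assumes [measurable]: "U \<in> borel_measurable borel" "A \<in> sets borel"
    and Z: "0 < partition_fun U \<theta>" "partition_fun U \<theta> < \<infinity>"
  shows "ennreal (measure (gibbs U \<theta>) A) * partition_fun U \<theta>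
       = (\<integral>\<^sup>+x. eexp (- (ereal \<theta> * U x)) * indicator A x \<partial>lborel)"
proof -
  let ?I = "\<integral>\<^sup>+x. eexp (- (ereal \<theta> * U x)) * indicator A x \<partial>lborel"
  have "emeasure (gibbs U \<theta>) A = (\<integral>\<^sup>+x. eexp (- (ereal \<theta> * U x)) * indicator A x / partition_fun U \<theta> \<partial>lborel)"
    unfolding gibbs_def by (subst emeasure_density) (auto simp: divide_ennreal_def mult_ac)
  also have "\<dots> = ?I / partition_fun U \<theta>"
    by (rule nn_integral_divide) auto
  finally have *: "emeasure (gibbs U \<theta>) A = ?I / partition_fun U \<theta>" .
  have "?I \<le> partition_fun U \<theta>"
    unfolding partition_fun_def by (intro nn_integral_mono) (auto split: split_indicator)
  hence "?I < \<infinity>" using Z(2) by simp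
  hence "emeasure (gibbs U \<theta>) A \<noteq> \<infinity>"
    using Z unfolding * by (auto simp: ennreal_divide_eq_top_iff)
  hence "ennreal (measure (gibbs U \<theta>) A) = ?I / partition_fun U \<theta>"
    by (simp add: emeasure_eq_ennreal_measure flip: *)
  hence "ennreal (measure (gibbs U \<theta>) A) * partition_fun U \<theta> = ?I * (partition_fun U \<theta> / partition_fun U \<theta>)"
    by (simp only: ennreal_divide_times)
  thus ?thesis using Z by simp
qed

lemma prob_space_gibbs:
  fixes U :: "real ^ 'd \<Rightarrow> ereal"
  assumes [measurable]: "U \<in> borel_measurable borel"
    and Z: "0 < partition_fun U \<theta>" "partition_fun U \<theta> < \<infinity>"
  shows "prob_space (gibbs U \<theta>)"
proof
  have "emeasure (gibbs U \<theta>) (space (gibbs U \<theta>)) = (\<integral>\<^sup>+x. eexp (- (ereal \<theta> * U x)) / partition_fun U \<theta> \<partial>lborel)"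
    unfolding gibbs_def by (subst emeasure_density) auto
  also have "\<dots> = partition_fun U \<theta> / partition_fun U \<theta>"
    unfolding partition_fun_def by (rule nn_integral_divide) auto
  finally show "emeasure (gibbs U \<theta>) (space (gibbs U \<theta>)) = 1" using Z by simp
qed

lemma sets_gibbs [simp, measurable_cong]: "sets (gibbs U \<theta>) = sets borel"
  by (simp add: gibbs_def)

lemma space_gibbs [simp]: "space (gibbs U \<theta>) = UNIV"
  by (simp add: gibbs_def)

text \<open>
  A pointwise comparison of two Boltzmann weights on \<open>A\<close>, stated in terms of the
  probabilities. It lets mass estimates be carried from one inverse temperature to another.
\<close>

lemma gibbs_mass_compare:
  fixes U :: "real ^ 'd \<Rightarrow> ereal"
  assumes [measurable]: "U \<in> borel_measurable borel" "A \<in> sets borel"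
    and Z: "0 < partition_fun U \<theta>" "partition_fun U \<theta> < \<infinity>" "partition_fun U \<theta>' < \<infinity>"
    and c: "c \<ge> 0"
    and le: "\<And>x. x \<in> A \<Longrightarrow> eexp (- (ereal \<theta> * U x)) \<le> ennreal c * eexp (- (ereal \<theta>' * U x))"
  shows "measure (gibbs U \<theta>) A * enn2real (partition_fun U \<theta>) \<le> c * enn2real (partition_fun U \<theta>')"
proof -
  have "ennreal (measure (gibbs U \<theta>) A) * partition_fun U \<theta>
      \<le> (\<integral>\<^sup>+x. ennreal c * eexp (- (ereal \<theta>' * U x)) \<partial>lborel)"
    unfolding ennreal_measure_gibbs_mult_partition_fun[OF assms(1,2) Z(1,2)]
    by (intro nn_integral_mono) (auto split: split_indicator simp: le)
  also have "\<dots> = ennreal c * partition_fun U \<theta>'"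
    unfolding partition_fun_def by (rule nn_integral_cmult) auto
  finally have "enn2real (ennreal (measure (gibbs U \<theta>) A) * partition_fun U \<theta>)
      \<le> enn2real (ennreal c * partition_fun U \<theta>')"
    using Z by (intro enn2real_mono) (auto simp: ennreal_mult_less_top)
  thus ?thesis using c by (simp add: enn2real_mult)
qed

text \<open>
  Passing from \<open>\<theta>\<close> to \<open>1\<close>, the weight picks up the factor \<open>exp (- (\<theta> - 1) U)\<close>, which is at
  most \<open>exp (- (\<theta> - 1) b)\<close> on the upper set and at least \<open>exp (- (\<theta> - 1) a)\<close> on the lower
  set. In the product of the two resulting estimates the partition functions cancel.
\<close>

lemma gibbs_tail_decay:
  fixes U :: "real ^ 'd \<Rightarrow> ereal"
  assumes meas [measurable]: "U \<in> borel_measurable borel"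
    and nonneg: "\<And>x. 0 \<le> U x"
    and Z: "\<And>\<theta>. \<theta> \<ge> 1 \<Longrightarrow> 0 < partition_fun U \<theta>" "\<And>\<theta>. \<theta> \<ge> 1 \<Longrightarrow> partition_fun U \<theta> < \<infinity>"
    and \<theta>: "\<theta> \<ge> 1"
  shows "measure (gibbs U \<theta>) {x. ereal b < U x} * measure (gibbs U 1) {x. U x \<le> ereal a}
       \<le> exp (- ((\<theta> - 1) * (b - a)))"
proof -
  let ?z = "\<lambda>\<theta>. enn2real (partition_fun U \<theta>)"
  let ?h = "measure (gibbs U \<theta>) {x. ereal b < U x}" and ?g = "measure (gibbs U 1) {x. U x \<le> ereal a}"
  have z: "?z \<theta> > 0" "?z 1 > 0"
    using Z[OF \<theta>] Z[of 1] by (auto simp: enn2real_positive_iff)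
  have A: "?h * ?z \<theta> \<le> exp (- ((\<theta> - 1) * b)) * ?z 1"
  proof (rule gibbs_mass_compare)
    fix x assume x: "x \<in> {x. ereal b < U x}"
    show "eexp (- (ereal \<theta> * U x)) \<le> ennreal (exp (- ((\<theta> - 1) * b))) * eexp (- (ereal 1 * U x))"
    proof (cases "U x")
      case (real r)
      have "(\<theta> - 1) * b \<le> (\<theta> - 1) * r" using x \<theta> real by (intro mult_left_mono) auto
      thus ?thesis
        using real by (simp add: eexp_def flip: ennreal_mult exp_add) (simp add: algebra_simps)
    qed (use nonneg[of x] \<theta> in \<open>auto simp: eexp_def\<close>)
  qed (use Z[OF \<theta>] Z[of 1] in auto)
  have B: "?g * ?z 1 \<le> exp ((\<theta> - 1) * a) * ?z \<theta>"
  proof (rule gibbs_mass_compare)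
    fix x assume x: "x \<in> {x. U x \<le> ereal a}"
    show "eexp (- (ereal 1 * U x)) \<le> ennreal (exp ((\<theta> - 1) * a)) * eexp (- (ereal \<theta> * U x))"
    proof (cases "U x")
      case (real r)
      have "(\<theta> - 1) * r \<le> (\<theta> - 1) * a" using x \<theta> real by (intro mult_left_mono) auto
      thus ?thesis
        using real by (simp add: eexp_def flip: ennreal_mult exp_add) (simp add: algebra_simps)
    qed (use nonneg[of x] x in auto)
  qed (use Z[OF \<theta>] Z[of 1] in auto)
  have "(?h * ?z \<theta>) * (?g * ?z 1) \<le> (exp (- ((\<theta> - 1) * b)) * ?z 1) * (exp ((\<theta> - 1) * a) * ?z \<theta>)"
    by (rule mult_mono[OF A B]) auto
  hence "(?h * ?g) * (?z \<theta> * ?z 1) \<le> (exp (- ((\<theta> - 1) * b)) * exp ((\<theta> - 1) * a)) * (?z \<theta> * ?z 1)"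
    by (simp add: mult_ac)
  hence "?h * ?g \<le> exp (- ((\<theta> - 1) * b)) * exp ((\<theta> - 1) * a)"
    using z by (simp add: mult_le_cancel_right)
  thus ?thesis by (simp flip: exp_add add: algebra_simps)
qed

lemma gibbs_mass_pos:
  fixes U :: "real ^ 'd \<Rightarrow> ereal"
  assumes meas [measurable]: "U \<in> borel_measurable borel"
    and nonneg: "\<And>x. 0 \<le> U x"
    and Z: "0 < partition_fun U \<theta>" "partition_fun U \<theta> < \<infinity>"
    and r: "r > 0" and le: "\<And>x. x \<in> ball c r \<Longrightarrow> U x \<le> ereal b"
  shows "measure (gibbs U \<theta>) {x. U x \<le> ereal b} > 0"
proof (rule ccontr)
  assume "\<not> ?thesis"
  hence "measure (gibbs U \<theta>) {x. U x \<le> ereal b} = 0"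
    using measure_nonneg[of "gibbs U \<theta>" "{x. U x \<le> ereal b}"] by linarith
  hence "(\<integral>\<^sup>+x. eexp (- (ereal \<theta> * U x)) * indicator {x. U x \<le> ereal b} x \<partial>lborel) = 0"
    using ennreal_measure_gibbs_mult_partition_fun[OF meas _ Z, of "{x. U x \<le> ereal b}"] by simp
  hence "AE x in lborel. eexp (- (ereal \<theta> * U x)) * indicator {x. U x \<le> ereal b} x = 0"
    by (subst (asm) nn_integral_0_iff_AE) auto
  hence "AE x in lborel. x \<notin> ball c r"
  proof eventually_elim
    case (elim x)
    show ?case
    proof
      assume x: "x \<in> ball c r"
      from le[OF x] nonneg[of x] obtain s where "U x = ereal s" by (cases "U x") auto
      with elim le[OF x] show False by (simp add: eexp_def)
    qed
  qed
  hence "emeasure lborel (ball c r) = 0"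
    by (subst (asm) AE_iff_measurable[of "ball c r"]) auto
  moreover have "measure lborel (ball c r) > 0" using r by (rule content_ball_pos)
  ultimately show False by (simp add: measure_def)
qed

section \<open>The optimisation error of an independent sample\<close>

text \<open>
  Superadditivity holds because \<open>z\<^sup>p = z \<cdot> z\<^sup>p\<^sup>-\<^sup>1\<close> and the second factor is increasing.
\<close>

lemma powr_add_le_add_powr:
  fixes x y p :: real
  assumes "x \<ge> 0" "y \<ge> 0" "p \<ge> 1"
  shows "x powr p + y powr p \<le> (x + y) powr p"
proof -
  have split: "z powr p = z * z powr (p - 1)" if "z \<ge> 0" for z :: real
    using powr_mult_base[OF that, of "p - 1"] by simp
  have "x * x powr (p - 1) + y * y powr (p - 1) \<le> x * (x + y) powr (p - 1) + y * (x + y) powr (p - 1)"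
    using assms by (intro add_mono mult_left_mono powr_mono2) auto
  thus ?thesis using assms by (simp add: split[symmetric] flip: distrib_right)
qed

text \<open>
  The \<open>p\<close>-th moment is at most \<open>t\<^sup>p + P(B)\<close>, and superadditivity of \<open>z\<^sup>p\<close> separates the two
  terms under the \<open>p\<close>-th root.
\<close>

lemma Lp_norm_le_add_exceptional_event:
  assumes "prob_space M" and B [measurable]: "B \<in> sets M"
    and p: "p \<ge> 1" and t: "t \<ge> 0"
    and bdd: "AE \<omega> in M. \<bar>f \<omega>\<bar> \<le> 1"
    and small: "AE \<omega> in M. \<omega> \<notin> B \<longrightarrow> \<bar>f \<omega>\<bar> \<le> t"
  shows "Lp_norm M p f \<le> ennreal (t + measure M B powr (1 / p))"
proof -
  interpret prob_space M by fact
  define b where "b = prob B"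
  have b: "b \<ge> 0" by (simp add: b_def)
  let ?I = "\<integral>\<^sup>+ \<omega>. ennreal (\<bar>f \<omega>\<bar> powr p) \<partial>M"
  have "?I \<le> (\<integral>\<^sup>+ \<omega>. ennreal (t powr p) + indicator B \<omega> \<partial>M)"
  proof (rule nn_integral_mono_AE)
    show "AE \<omega> in M. ennreal (\<bar>f \<omega>\<bar> powr p) \<le> ennreal (t powr p) + indicator B \<omega>"
      using bdd small
    proof eventually_elim
      case (elim \<omega>)
      show ?case
      proof (cases "\<omega> \<in> B")
        case True
        have "\<bar>f \<omega>\<bar> powr p \<le> 1 powr p" using elim p by (intro powr_mono2) auto
        hence "ennreal (\<bar>f \<omega>\<bar> powr p) \<le> 1" by simp
        also have "\<dots> \<le> ennreal (t powr p) + indicator B \<omega>" using True by simp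
        finally show ?thesis .
      next
        case False
        thus ?thesis using elim p by (auto intro!: ennreal_leI powr_mono2)
      qed
    qed
  qed
  also have "\<dots> = ennreal (t powr p + b)"
    by (subst nn_integral_add) (auto simp: prob_space emeasure_eq_measure b_def)
  finally have I: "?I \<le> ennreal (t powr p + b)" .
  hence "?I \<noteq> \<infinity>" by (auto simp: top_unique)
  moreover have "enn2real ?I powr (1 / p) \<le> t + b powr (1 / p)"
  proof -
    have "enn2real ?I \<le> t powr p + b"
      using enn2real_mono[OF I] b by (simp del: ennreal_plus)
    also have "\<dots> = t powr p + (b powr (1 / p)) powr p"
      using b p by (simp add: powr_powr)
    also have "\<dots> \<le> (t + b powr (1 / p)) powr p"
      using t p by (intro powr_add_le_add_powr) auto
    finally have "enn2real ?I powr (1 / p) \<le> ((t + b powr (1 / p)) powr p) powr (1 / p)"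
      using p by (intro powr_mono2) auto
    thus ?thesis using t p by (simp add: powr_powr)
  qed
  ultimately show ?thesis by (simp add: Lp_norm_def Let_def b_def ennreal_leI)
qed

lemma abs_gap_error_le:
  assumes u: "U xs = ereal u" and lb: "\<And>n. n \<in> {1..N} \<Longrightarrow> ereal u \<le> U (Y n \<omega>)"
  shows "\<bar>gap_error U xs N Y \<omega>\<bar> \<le> 1"
    and "n \<in> {1..N} \<Longrightarrow> U (Y n \<omega>) \<le> ereal (u + t) \<Longrightarrow> \<bar>gap_error U xs N Y \<omega>\<bar> \<le> t"
proof -
  define I where "I = (INF n\<in>{1..N}. U (Y n \<omega>))"
  have lbI: "ereal u \<le> I" unfolding I_def by (rule INF_greatest) (rule lb)
  have gap: "gap_error U xs N Y \<omega> = 1 - enn2real (eexp (ereal u - I))"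
    by (simp add: gap_error_def I_def u)
  show "\<bar>gap_error U xs N Y \<omega>\<bar> \<le> 1"
    using lbI by (cases I) (auto simp: gap eexp_def)
  assume "n \<in> {1..N}" "U (Y n \<omega>) \<le> ereal (u + t)"
  hence "I \<le> ereal (u + t)" unfolding I_def by (rule INF_lower2)
  with lbI obtain i where i: "I = ereal i" "u \<le> i" "i \<le> u + t" by (cases I) auto
  have "1 - exp (u - i) \<le> t"
    using exp_ge_add_one_self[of "u - i"] i by linarith
  with i show "\<bar>gap_error U xs N Y \<omega>\<bar> \<le> t"
    by (simp add: gap eexp_def)
qed

text \<open>
  The exceptional event is that every sample point misses the sublevel set \<open>{U \<le> u + t}\<close>; by
  independence its probability is the \<open>N\<close>-th power of the probability for one point. For
  the limit \<open>\<theta> \<rightarrow> \<infinity>\<close> the bound must contain this power itself and not its exponential majorant,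
  which does not tend to 0 when the mass of the sublevel set tends to 1.
\<close>

lemma Lp_norm_gap_error_le:
  fixes U :: "real ^ 'd \<Rightarrow> ereal"
  assumes M: "prob_space M" and Y: "iid_sample M \<mu> N Y" and N: "N \<ge> 1"
    and U [measurable]: "U \<in> borel_measurable borel"
    and u: "U xs = ereal u" and min: "AE x in \<mu>. ereal u \<le> U x"
    and p: "p \<ge> 1" and t: "t \<ge> 0"
  shows "Lp_norm M p (gap_error U xs N Y)
       \<le> ennreal (t + measure \<mu> {x. ereal (u + t) < U x} powr (real N / p))"
proof -
  interpret prob_space M by fact
  have indep: "indep_vars (\<lambda>_. borel) Y {1..N}"
    and law: "\<And>n. n \<in> {1..N} \<Longrightarrow> distr M borel (Y n) = \<mu>"
    using Y by (auto simp: iid_sample_def)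
  have Y_meas: "Y n \<in> borel_measurable M" if "n \<in> {1..N}" for n
    using indep that by (auto simp: indep_vars_def)
  define S where "S = {x. ereal (u + t) < U x}"
  have S [measurable]: "S \<in> sets borel" by (simp add: S_def)
  define B where "B = (\<Inter>n\<in>{1..N}. Y n -` S \<inter> space M)"
  have "prob B = (\<Prod>n\<in>{1..N}. prob (Y n -` S \<inter> space M))"
    unfolding B_def using N by (intro indep_varsD_finite[OF indep]) auto
  also have "\<dots> = (\<Prod>n\<in>{1..N}. measure \<mu> S)"
    by (intro prod.cong refl) (simp add: measure_distr[OF Y_meas] flip: law)
  finally have prob_B: "prob B = measure \<mu> S ^ N" by simp
  have lb: "AE \<omega> in M. \<forall>n\<in>{1..N}. ereal u \<le> U (Y n \<omega>)"
  proof (rule AE_finite_allI)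
    fix n assume n: "n \<in> {1..N}"
    have "AE x in distr M borel (Y n). ereal u \<le> U x" unfolding law[OF n] by (rule min)
    thus "AE \<omega> in M. ereal u \<le> U (Y n \<omega>)"
      by (subst (asm) AE_distr_iff[OF Y_meas[OF n]]) auto
  qed simp
  have "Lp_norm M p (gap_error U xs N Y) \<le> ennreal (t + prob B powr (1 / p))"
  proof (rule Lp_norm_le_add_exceptional_event[OF M _ p t])
    show "B \<in> events"
      unfolding B_def using N by (intro sets.finite_INT measurable_sets[OF Y_meas]) auto
    show "AE \<omega> in M. \<bar>gap_error U xs N Y \<omega>\<bar> \<le> 1"
      using lb by eventually_elim (rule abs_gap_error_le(1)[of U xs u], use u in auto)
    show "AE \<omega> in M. \<omega> \<notin> B \<longrightarrow> \<bar>gap_error U xs N Y \<omega>\<bar> \<le> t"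
      using lb AE_space
    proof eventually_elim
      case (elim \<omega>)
      show ?case
      proof
        assume "\<omega> \<notin> B"
        then obtain n where "n \<in> {1..N}" "U (Y n \<omega>) \<le> ereal (u + t)"
          using elim N by (auto simp: B_def S_def not_less)
        thus "\<bar>gap_error U xs N Y \<omega>\<bar> \<le> t"
          using elim by (intro abs_gap_error_le(2)[of U xs u]) (auto simp: u)
      qed
    qed
  qed
  also have "prob B powr (1 / p) = measure \<mu> S powr (real N / p)"
    unfolding prob_B using N by (simp add: powr_powr flip: powr_realpow')
  finally show ?thesis by (simp add: S_def)
qed


section \<open>Mass near the minimum and the limits of the error\<close>

text \<open>
  Imposing the growth bounds almost everywhere covers functions whose growth is controlled only
  inside and outside a sphere. The upper bound is used on the ball where the Gamma variable
  \<open>\<theta> \<kappa>\<^sub>1 |x - c|\<^sup>m\<close> is below its mean \<open>d / m\<close>, and there it gives \<open>U \<le> u + d / (\<theta> m)\<close>.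
\<close>

lemma gibbs_mass_near_minimum:
  fixes U :: "real ^ 'd \<Rightarrow> ereal" and c :: "real ^ 'd"
  assumes meas [measurable]: "U \<in> borel_measurable borel"
    and Z: "0 < partition_fun U \<theta>" "partition_fun U \<theta> < \<infinity>"
    and \<kappa>: "0 \<le> \<kappa>0" "0 < \<kappa>1" and m: "0 < m" and \<theta>: "0 < \<theta>"
    and lower: "AE x in lborel. ereal (u + \<kappa>0 * norm (x - c) powr m) \<le> U x"
    and upper: "AE x in lborel. \<theta> * \<kappa>1 * norm (x - c) powr m \<le> real CARD('d) / m \<longrightarrow>
                  U x \<le> ereal (u + \<kappa>1 * norm (x - c) powr m)"
  shows "(\<kappa>0 / \<kappa>1) powr (real CARD('d) / m) / 2
       \<le> measure (gibbs U \<theta>) {x. U x \<le> ereal (u + real CARD('d) / (\<theta> * m))}" (is "?q \<le> measure _ ?A")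
proof -
  define a where "a = real CARD('d) / m"
  have a: "a = real DIM(real ^ 'd) / m" by (simp add: a_def)
  define l0 l1 where "l0 = \<theta> * \<kappa>0" and "l1 = \<theta> * \<kappa>1"
  have l: "l0 \<ge> 0" "l1 > 0" using \<kappa> \<theta> by (auto simp: l0_def l1_def)
  let ?J = "\<lambda>l x. ennreal (exp (- (l * norm (x - c) powr m)))"
  let ?E = "ennreal (exp (- (\<theta> * u)))"
  let ?w = "\<lambda>x. eexp (- (ereal \<theta> * U x))"
  have "partition_fun U \<theta> \<le> (\<integral>\<^sup>+x. ?E * ?J l0 x \<partial>lborel)"
    unfolding partition_fun_def
  proof (rule nn_integral_mono_AE)
    show "AE x in lborel. ?w x \<le> ?E * ?J l0 x"
      using lower
    proof eventually_elim
      case (elim x)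
      show ?case
      proof (cases "U x")
        case (real s)
        have "\<theta> * (u + \<kappa>0 * norm (x - c) powr m) \<le> \<theta> * s"
          using elim \<theta> real by (intro mult_left_mono) auto
        thus ?thesis
          using real by (simp add: eexp_def l0_def flip: ennreal_mult exp_add) (simp add: algebra_simps)
      qed (use elim \<theta> in \<open>auto simp: eexp_def\<close>)
    qed
  qed
  hence "ennreal ?q * partition_fun U \<theta> \<le> ennreal ?q * (\<integral>\<^sup>+x. ?E * ?J l0 x \<partial>lborel)"
    by (rule mult_left_mono) simp
  also have "\<dots> = ?E * (ennreal ((l0 / l1) powr a / 2) * (\<integral>\<^sup>+x. ?J l0 x \<partial>lborel))"
    using \<theta> by (subst nn_integral_cmult) (auto simp: a_def l0_def l1_def mult_ac)
  also have "\<dots> \<le> ?E * (\<integral>\<^sup>+x. ?J l1 x * indicator {x. l1 * norm (x - c) powr m \<le> a} x \<partial>lborel)"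
    by (intro mult_left_mono exp_radial_half_mass l m a) auto
  also have "\<dots> = (\<integral>\<^sup>+x. ?E * (?J l1 x * indicator {x. l1 * norm (x - c) powr m \<le> a} x) \<partial>lborel)"
    by (rule nn_integral_cmult[symmetric]) measurable
  also have "\<dots> \<le> (\<integral>\<^sup>+x. ?w x * indicator ?A x \<partial>lborel)"
  proof (rule nn_integral_mono_AE)
    show "AE x in lborel. ?E * (?J l1 x * indicator {x. l1 * norm (x - c) powr m \<le> a} x) \<le> ?w x * indicator ?A x"
      using lower upper
    proof eventually_elim
      case (elim x)
      show ?case
      proof (cases "l1 * norm (x - c) powr m \<le> a")
        case True
        hence ub: "U x \<le> ereal (u + \<kappa>1 * norm (x - c) powr m)"
          using elim(2) by (simp add: l1_def a_def)
        with elim(1) obtain s where s: "U x = ereal s" "s \<le> u + \<kappa>1 * norm (x - c) powr m"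
          by (cases "U x") auto
        have "\<kappa>1 * norm (x - c) powr m \<le> a / \<theta>"
          using True \<theta> by (simp add: l1_def field_simps)
        hence "x \<in> ?A" using s \<theta> by (simp add: a_def field_simps)
        moreover have "\<theta> * s \<le> \<theta> * (u + \<kappa>1 * norm (x - c) powr m)"
          using s \<theta> by (intro mult_left_mono) auto
        hence "?E * ?J l1 x \<le> ?w x"
          using s by (simp add: eexp_def l1_def flip: ennreal_mult exp_add) (simp add: algebra_simps)
        ultimately show ?thesis using True by simp
      qed simp
    qed
  qed
  also have "\<dots> = ennreal (measure (gibbs U \<theta>) ?A) * partition_fun U \<theta>"
    by (rule ennreal_measure_gibbs_mult_partition_fun[symmetric, OF meas _ Z]) measurable
  finally have "enn2real (ennreal ?q * partition_fun U \<theta>)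
      \<le> enn2real (ennreal (measure (gibbs U \<theta>) ?A) * partition_fun U \<theta>)"
    using Z by (intro enn2real_mono) (auto simp: ennreal_mult_less_top)
  moreover have "enn2real (partition_fun U \<theta>) > 0"
    using Z by (simp add: enn2real_positive_iff)
  ultimately show ?thesis by (simp add: enn2real_mult mult_le_cancel_right)
qed

text \<open>
  The order of limits: first \<open>g t\<close> vanishes for fixed \<open>t\<close>, then \<open>t\<close> is made small.
\<close>

lemma ennreal_tendsto_zero_if_le_add:
  fixes f :: "'a \<Rightarrow> ennreal" and g :: "real \<Rightarrow> 'a \<Rightarrow> real"
  assumes le: "\<And>t. t > 0 \<Longrightarrow> eventually (\<lambda>x. f x \<le> ennreal (t + g t x)) F"
    and lim: "\<And>t. t > 0 \<Longrightarrow> (g t \<longlongrightarrow> 0) F"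
  shows "(f \<longlongrightarrow> 0) F"
proof (rule order_tendstoI)
  fix y :: ennreal assume "0 < y"
  then obtain z where z: "0 < z" "z < y" using dense by blast
  then obtain e where "z = ennreal e" by (cases z) auto
  with z have e: "0 < e" "ennreal e < y" by (auto simp: ennreal_less_zero_iff)
  have "eventually (\<lambda>x. f x \<le> ennreal (e / 2 + g (e / 2) x)) F"
    by (rule le) (use e in simp)
  moreover have "eventually (\<lambda>x. g (e / 2) x < e / 2) F"
    using order_tendstoD(2)[OF lim, of "e / 2" "e / 2"] e by simp
  ultimately show "eventually (\<lambda>x. f x < y) F"
  proof eventually_elim
    case (elim x)
    have "ennreal (e / 2 + g (e / 2) x) \<le> ennreal e" using elim by (intro ennreal_leI) simp
    with elim(1) e(2) show ?case by (meson order.trans le_less_trans)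
  qed
qed simp

theorem corollary2p9:
  fixes U :: "real ^ 'd \<Rightarrow> ereal" and xs :: "real ^ 'd"
    and \<kappa>0 \<kappa>1 m :: real and R :: ereal
    and M :: "'w measure"
    and X :: "real \<Rightarrow> nat \<Rightarrow> nat \<Rightarrow> 'w \<Rightarrow> real ^ 'd"
  assumes U_meas: "U \<in> borel_measurable borel"
    and U_nonneg: "\<And>x. 0 \<le> U x"
    and Z_pos: "\<And>\<theta>. \<theta> \<ge> 1 \<Longrightarrow> 0 < partition_fun U \<theta>"
    and Z_finite: "\<And>\<theta>. \<theta> \<ge> 1 \<Longrightarrow> partition_fun U \<theta> < \<infinity>"
    and \<kappa>: "0 \<le> \<kappa>0" "\<kappa>0 < \<kappa>1"
    and m: "0 < m"
    and R: "0 < R"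
    and xs: "U xs < \<infinity>"
    and outside: "\<And>x. ereal (norm (x - xs)) > R \<Longrightarrow> U x = \<infinity>"
    and lower: "\<And>x. ereal (norm (x - xs)) < R \<Longrightarrow> ereal (\<kappa>0 * norm (x - xs) powr m) \<le> U x - U xs"
    and upper: "\<And>x. ereal (norm (x - xs)) < R \<Longrightarrow> U x - U xs \<le> ereal (\<kappa>1 * norm (x - xs) powr m)"
    and M: "prob_space M"
    and X: "\<And>\<theta> N. \<theta> \<ge> 1 \<Longrightarrow> N \<ge> 1 \<Longrightarrow> iid_sample M (gibbs U \<theta>) N (X \<theta> N)"
  shows "(\<forall>p\<ge>1. \<forall>N\<ge>1. \<forall>\<theta>\<ge>1. \<theta> \<ge> theta_threshold (real CARD('d)) m \<kappa>1 R \<longrightarrow>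
            Lp_norm M p (gap_error U xs N (X \<theta> N))
              \<le> ennreal (real CARD('d) / (\<theta> * m)
                  + exp (- (real N * (\<kappa>0 / \<kappa>1) powr (real CARD('d) / m) / (2 * p)))))
       \<and> (\<forall>p\<ge>1. \<forall>N\<ge>1. \<exists>L.
            ((\<lambda>\<theta>. Lp_norm M p (gap_error U xs N (X \<theta> N))) \<longlongrightarrow> L) at_top
            \<and> L \<le> ennreal (exp (- (real N * (\<kappa>0 / \<kappa>1) powr (real CARD('d) / m) / p))))
       \<and> (\<forall>p\<ge>1. \<forall>\<theta>\<ge>1. \<theta> \<ge> theta_threshold (real CARD('d)) m \<kappa>1 R \<longrightarrow> (\<exists>L.
            (\<lambda>N. Lp_norm M p (gap_error U xs N (X \<theta> N))) \<longlonglongrightarrow> L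
            \<and> L \<le> ennreal (real CARD('d) / (\<theta> * m))))"
proof -
  let ?d = "real CARD('d)"
  let ?F = "\<lambda>p \<theta> N. Lp_norm M p (gap_error U xs N (X \<theta> N))"
  have \<kappa>1: "\<kappa>1 > 0" using \<kappa> by simp
  obtain u where u: "U xs = ereal u" using xs U_nonneg[of xs] by (cases "U xs") auto
  have low: "ereal (u + \<kappa>0 * norm (x - xs) powr m) \<le> U x" if "ereal (norm (x - xs)) \<noteq> R" for x
  proof (cases "ereal (norm (x - xs)) < R")
    case True
    from lower[OF True] u show ?thesis by (cases "U x") (auto simp: algebra_simps)
  next
    case False
    with that outside[of x] show ?thesis by auto
  qed
  have up: "U x \<le> ereal (u + \<kappa>1 * norm (x - xs) powr m)" if "ereal (norm (x - xs)) < R" for x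
    using upper[OF that] u by (cases "U x") (auto simp: algebra_simps)
  have off_sphere: "AE x in lborel. ereal (norm (x - xs)) \<noteq> R"
  proof (cases R)
    case (real r)
    have "sphere xs r \<in> null_sets lborel"
      using negligible_sphere[of xs r]
      by (auto simp: null_sets_completion_iff negligible_iff_null_sets)
    hence "AE x in lborel. x \<notin> sphere xs r" by (rule AE_not_in)
    thus ?thesis by eventually_elim (auto simp: real dist_norm norm_minus_commute)
  qed auto
  have low_AE: "AE x in lborel. ereal (u + \<kappa>0 * norm (x - xs) powr m) \<le> U x"
    using off_sphere by eventually_elim (rule low)

  have min_AE: "AE x in gibbs U \<theta>. ereal u \<le> U x" for \<theta>
  proof -
    have "AE x in lborel. ereal u \<le> U x"
      using low_AE
    proof eventually_elim
      case (elim x)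
      have "ereal u \<le> ereal (u + \<kappa>0 * norm (x - xs) powr m)" using \<kappa> by simp
      thus ?case using elim by (rule order_trans)
    qed
    thus ?thesis
      unfolding gibbs_def using U_meas by (subst AE_density) auto
  qed

  define h where "h = (\<lambda>\<theta> t. measure (gibbs U \<theta>) {x. ereal (u + t) < U x})"
  have h_nonneg: "h \<theta> t \<ge> 0" for \<theta> t by (simp add: h_def)
  have bound: "?F p \<theta> N \<le> ennreal (t + h \<theta> t powr (real N / p))"
    if "p \<ge> 1" "\<theta> \<ge> 1" "N \<ge> 1" "t \<ge> 0" for p \<theta> N t
    unfolding h_def using that
    by (intro Lp_norm_gap_error_le[where U = U and u = u] M X U_meas u min_AE) auto
  have h_compl: "h \<theta> t = 1 - measure (gibbs U \<theta>) {x. U x \<le> ereal (u + t)}" if "\<theta> \<ge> 1" for \<theta> t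
  proof -
    interpret G: prob_space "gibbs U \<theta>"
      by (rule prob_space_gibbs[OF U_meas Z_pos[OF that] Z_finite[OF that]])
    have "h \<theta> t = G.prob (space (gibbs U \<theta>) - {x. U x \<le> ereal (u + t)})"
      unfolding h_def by (rule arg_cong[where f = "measure _"]) auto
    also have "\<dots> = 1 - G.prob {x. U x \<le> ereal (u + t)}"
      using U_meas by (intro G.prob_compl) measurable
    finally show ?thesis .
  qed
  have pos: "measure (gibbs U \<theta>) {x. U x \<le> ereal (u + t)} > 0" if "\<theta> \<ge> 1" "t > 0" for \<theta> t
  proof -
    \<comment> \<open>On the ball of radius \<open>r0\<close> the upper growth bound, as far as it is available, is at most \<open>t\<close>.\<close>
    define r0 where "r0 = (t / \<kappa>1) powr (1 / m)"
    have r0: "r0 > 0" using that \<kappa>1 by (simp add: r0_def)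
    have "0 < min (ereal r0) R" using R r0 by simp
    then obtain r where r: "0 < ereal r" "ereal r < min (ereal r0) R"
      using ereal_dense2 by blast
    show ?thesis
    proof (rule gibbs_mass_pos[OF U_meas U_nonneg Z_pos[OF that(1)] Z_finite[OF that(1)], of r xs])
      fix x assume "x \<in> ball xs r"
      hence x: "norm (x - xs) < r" by (simp add: dist_norm norm_minus_commute)
      have "ereal (norm (x - xs)) < ereal r" using x by simp
      also have "\<dots> < R" using r by simp
      finally have "U x \<le> ereal (u + \<kappa>1 * norm (x - xs) powr m)" by (rule up)
      also have "norm (x - xs) powr m \<le> r0 powr m"
        using x r m by (intro powr_mono2) auto
      hence "\<kappa>1 * norm (x - xs) powr m \<le> t"
        using \<kappa>1 that m by (simp add: r0_def powr_powr field_simps)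
      hence "ereal (u + \<kappa>1 * norm (x - xs) powr m) \<le> ereal (u + t)" by simp
      finally show "U x \<le> ereal (u + t)" .
    qed (use r in simp)
  qed

  have part1: "?F p \<theta> N \<le> ennreal (?d / (\<theta> * m) + exp (- (real N * (\<kappa>0 / \<kappa>1) powr (?d / m) / (2 * p))))"
    if p: "p \<ge> 1" and N: "N \<ge> 1" and \<theta>: "\<theta> \<ge> 1" and thr: "\<theta> \<ge> theta_threshold ?d m \<kappa>1 R" for p N \<theta>
  proof -
    define t where "t = ?d / (\<theta> * m)"
    have t: "t \<ge> 0" using \<theta> m by (simp add: t_def)
    define q where "q = (\<kappa>0 / \<kappa>1) powr (?d / m) / 2"
    have up_AE: "AE x in lborel. \<theta> * \<kappa>1 * norm (x - xs) powr m \<le> ?d / m \<longrightarrow>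
                  U x \<le> ereal (u + \<kappa>1 * norm (x - xs) powr m)"
      using off_sphere
    proof eventually_elim
      case (elim x)
      show ?case
      proof
        assume small: "\<theta> * \<kappa>1 * norm (x - xs) powr m \<le> ?d / m"
        have "ereal (norm (x - xs)) \<le> R"
        proof (cases R)
          case (real r)
          with R have r: "r > 0" by simp
          have "?d / m \<le> \<theta> * \<kappa>1 * r powr m"
            using thr r m \<kappa>1 by (simp add: real theta_threshold_def field_simps)
          with small have "\<theta> * \<kappa>1 * norm (x - xs) powr m \<le> \<theta> * \<kappa>1 * r powr m" by linarith
          hence "norm (x - xs) powr m \<le> r powr m"
            using \<theta> \<kappa>1 by (simp add: mult_le_cancel_left_pos)
          hence "norm (x - xs) \<le> r"
            using m r powr_less_mono2[of m r "norm (x - xs)"] by fastforce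
          thus ?thesis by (simp add: real)
        qed (use R in auto)
        with elim show "U x \<le> ereal (u + \<kappa>1 * norm (x - xs) powr m)" by (intro up) auto
      qed
    qed
    have "q \<le> measure (gibbs U \<theta>) {x. U x \<le> ereal (u + t)}"
      unfolding q_def t_def
      by (rule gibbs_mass_near_minimum[OF U_meas Z_pos[OF \<theta>] Z_finite[OF \<theta>] \<kappa>(1) \<kappa>1 m _ low_AE up_AE])
         (use \<theta> in simp)
    hence "h \<theta> t \<le> 1 - q" using h_compl[OF \<theta>] by simp
    also have "\<dots> \<le> exp (- q)" using exp_ge_add_one_self[of "- q"] by simp
    finally have "h \<theta> t powr (real N / p) \<le> exp (- q) powr (real N / p)"
      using p h_nonneg by (intro powr_mono2) auto
    also have "\<dots> = exp (- (real N * (\<kappa>0 / \<kappa>1) powr (?d / m) / (2 * p)))"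
      by (simp add: exp_powr_real q_def)
    finally have "ennreal (t + h \<theta> t powr (real N / p))
        \<le> ennreal (t + exp (- (real N * (\<kappa>0 / \<kappa>1) powr (?d / m) / (2 * p))))"
      by (intro ennreal_leI) simp
    with bound[OF p \<theta> N t] show ?thesis unfolding t_def by (rule order_trans)
  qed

  have part2: "((\<lambda>\<theta>. ?F p \<theta> N) \<longlongrightarrow> 0) at_top" if p: "p \<ge> 1" and N: "N \<ge> 1" for p N
  proof (rule ennreal_tendsto_zero_if_le_add[where g = "\<lambda>t \<theta>. h \<theta> t powr (real N / p)"])
    fix t :: real assume t: "t > 0"
    show "eventually (\<lambda>\<theta>. ?F p \<theta> N \<le> ennreal (t + h \<theta> t powr (real N / p))) at_top"
      using eventually_ge_at_top[of 1] by eventually_elim (use p N t in \<open>intro bound; simp\<close>)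
    \<comment> \<open>Comparing the levels \<open>u + t\<close> and \<open>u + t / 2\<close> leaves the positive gap \<open>t / 2\<close> as decay rate.\<close>
    define g where "g = measure (gibbs U 1) {x. U x \<le> ereal (u + t / 2)}"
    have g: "g > 0" using pos[of 1 "t / 2"] t by (simp add: g_def)
    have "((\<lambda>\<theta>. h \<theta> t) \<longlongrightarrow> 0) at_top"
    proof (rule tendsto_sandwich[of "\<lambda>_. 0" _ _ "\<lambda>\<theta>. exp (- ((\<theta> - 1) * (t / 2))) / g"])
      show "eventually (\<lambda>\<theta>. h \<theta> t \<le> exp (- ((\<theta> - 1) * (t / 2))) / g) at_top"
        using eventually_ge_at_top[of 1]
      proof eventually_elim
        case (elim \<theta>)
        have "h \<theta> t * g \<le> exp (- ((\<theta> - 1) * (t / 2)))"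
          using gibbs_tail_decay[OF U_meas U_nonneg Z_pos Z_finite elim, of "u + t" "u + t / 2"]
          by (simp add: h_def g_def)
        thus ?case using g by (simp add: field_simps)
      qed
      show "((\<lambda>\<theta>. exp (- ((\<theta> - 1) * (t / 2))) / g) \<longlongrightarrow> 0) at_top"
        using t g by real_asymp
    qed (auto simp: h_nonneg)
    thus "((\<lambda>\<theta>. h \<theta> t powr (real N / p)) \<longlongrightarrow> 0) at_top"
      using p N h_nonneg by (intro tendsto_zero_powrI[where b = "real N / p"]) auto
  qed

  have part3: "(\<lambda>N. ?F p \<theta> N) \<longlonglongrightarrow> 0" if p: "p \<ge> 1" and \<theta>: "\<theta> \<ge> 1" for p \<theta>
  proof (rule ennreal_tendsto_zero_if_le_add[where g = "\<lambda>t N. h \<theta> t powr (real N / p)"])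
    fix t :: real assume t: "t > 0"
    show "eventually (\<lambda>N. ?F p \<theta> N \<le> ennreal (t + h \<theta> t powr (real N / p))) sequentially"
      using eventually_ge_at_top[of 1] by eventually_elim (use p \<theta> t in \<open>intro bound; simp\<close>)
    have "h \<theta> t < 1" using pos[OF \<theta> t] h_compl[OF \<theta>] by simp
    hence "h \<theta> t powr (1 / p) < 1"
      using p h_nonneg powr_less_mono2[of "1 / p" "h \<theta> t" 1] by simp
    hence "(\<lambda>N. (h \<theta> t powr (1 / p)) ^ N) \<longlonglongrightarrow> 0" by (intro LIMSEQ_power_zero) simp
    \<comment> \<open>The case \<open>N = 0\<close> must be left out: if \<open>h \<theta> t = 0\<close>, then \<open>0 ^ 0 = 1\<close> but \<open>0 powr 0 = 0\<close>.\<close>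
    moreover have "eventually (\<lambda>N. (h \<theta> t powr (1 / p)) ^ N = h \<theta> t powr (real N / p)) sequentially"
      using eventually_gt_at_top[of 0] by eventually_elim (simp add: powr_powr flip: powr_realpow')
    ultimately show "(\<lambda>N. h \<theta> t powr (real N / p)) \<longlonglongrightarrow> 0"
      by (rule Lim_transform_eventually)
  qed

  show ?thesis
  proof (intro conjI allI impI)
    fix p :: real and N :: nat and \<theta> :: real
    assume "1 \<le> p" "1 \<le> N" "1 \<le> \<theta>" "theta_threshold ?d m \<kappa>1 R \<le> \<theta>"
    thus "?F p \<theta> N \<le> ennreal (?d / (\<theta> * m) + exp (- (real N * (\<kappa>0 / \<kappa>1) powr (?d / m) / (2 * p))))"
      by (rule part1)
  next
    fix p :: real and N :: nat
    assume "1 \<le> p" "1 \<le> N"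
    from part2[OF this] show "\<exists>L. ((\<lambda>\<theta>. ?F p \<theta> N) \<longlongrightarrow> L) at_top
        \<and> L \<le> ennreal (exp (- (real N * (\<kappa>0 / \<kappa>1) powr (?d / m) / p)))"
      by (intro exI[of _ 0]) simp
  next
    fix p \<theta> :: real
    assume "1 \<le> p" "1 \<le> \<theta>"
    from part3[OF this] show "\<exists>L. (\<lambda>N. ?F p \<theta> N) \<longlonglongrightarrow> L \<and> L \<le> ennreal (?d / (\<theta> * m))"
      by (intro exI[of _ 0]) simp
  qed
qed

end
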